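(* Let $L\subset\mathbb{R}^2$ be a full-rank lattice, let $\boldsymbol{\alpha}\in\mathbb{R}^2$, let $N\in\mathbb{N}$ (so $N\ge 1$), and let $\|\cdot\|$ be an arbitrary norm on $\mathbb{R}^2$. Then $$g_N^{\|\cdot\|}(\boldsymbol{\alpha},L)\leq 5,$$ where $g_N^{\|\cdot\|}(\boldsymbol{\alpha},L)$ is the number of distinct nearest-neighbour distances defined in the context.
   Context: A full-rank lattice in $\mathbb{R}^2$ is the set of integer linear combinations of a basis of $\mathbb{R}^2$. For $1\leq n\leq N$ set $$\delta_{n,N}^{\|\cdot\|}=\min\bigl\{\|n\boldsymbol{\alpha}-m\boldsymbol{\alpha}-\ell\| : 1\leq m\leq N,\ m\in\mathbb{Z},\ \ell\in L,\ n\boldsymbol{\alpha}-m\boldsymbol{\alpha}-\ell\neq 0\bigr\}$$ (the value $m=n$ is allowed; only the zero displacement vector is excluded; the minimum exists). Then $$g_N^{\|\cdot\|}(\boldsymbol{\alpha},L)=\#\bigl\{\delta_{n,N}^{\|\cdot\|}:1\leq n\leq N\bigr\}.$$ *)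

theory Defs
  imports "HOL-Analysis.Analysis"
begin

definition is_norm :: "('a::real_vector \<Rightarrow> real) \<Rightarrow> bool" where
  "is_norm p \<longleftrightarrow>
     (\<forall>x. 0 \<le> p x) \<and>
     (\<forall>x. p x = 0 \<longleftrightarrow> x = 0) \<and>
     (\<forall>c x. p (c *\<^sub>R x) = \<bar>c\<bar> * p x) \<and>
     (\<forall>x y. p (x + y) \<le> p x + p y)"

text \<open>The basis \<open>B\<close> is a set of linearly independent vectors; in a Euclidean space it is
  automatically finite, so the sum below is a genuine one.\<close>

definition full_rank_lattice :: "'a::euclidean_space set \<Rightarrow> bool" where
  "full_rank_lattice L \<longleftrightarrow>
     (\<exists>B. independent B \<and> span B = UNIV \<and>
          L = range (\<lambda>c :: 'a \<Rightarrow> int. \<Sum>b\<in>B. of_int (c b) *\<^sub>R b))"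

definition nn_dists ::
    "('a::real_vector \<Rightarrow> real) \<Rightarrow> 'a \<Rightarrow> 'a set \<Rightarrow> nat \<Rightarrow> nat \<Rightarrow> real set" where
  "nn_dists p \<alpha> L N n =
     {p (real n *\<^sub>R \<alpha> - real m *\<^sub>R \<alpha> - l) | m l.
        m \<in> {1..N} \<and> l \<in> L \<and> real n *\<^sub>R \<alpha> - real m *\<^sub>R \<alpha> - l \<noteq> 0}"

text \<open>\<open>LEAST\<close> on the reals is only meaningful when the minimum is attained;
  see \<open>nn_dist_is_minimum\<close> below.\<close>

definition nn_dist ::
    "('a::real_vector \<Rightarrow> real) \<Rightarrow> 'a \<Rightarrow> 'a set \<Rightarrow> nat \<Rightarrow> nat \<Rightarrow> real" where
  "nn_dist p \<alpha> L N n = (LEAST d. d \<in> nn_dists p \<alpha> L N n)"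

definition num_nn_dists ::
    "('a::real_vector \<Rightarrow> real) \<Rightarrow> 'a \<Rightarrow> 'a set \<Rightarrow> nat \<Rightarrow> nat" where
  "num_nn_dists p \<alpha> L N = card (nn_dist p \<alpha> L N ` {1..N})"

lemma is_norm_lower_bound:
  fixes p :: "'a::euclidean_space \<Rightarrow> real"
  assumes "is_norm p"
  obtains c where "c > 0" "\<And>x. c * norm x \<le> p x"
proof -
  have nn: "\<And>x. 0 \<le> p x" and z: "\<And>x. p x = 0 \<longleftrightarrow> x = 0"
    and sc: "\<And>c x. p (c *\<^sub>R x) = \<bar>c\<bar> * p x" and tr: "\<And>x y. p (x + y) \<le> p x + p y"
    using assms unfolding is_norm_def by blast+
  define K where "K = (\<Sum>b\<in>Basis. p (b::'a))"
  have sumle: "p (sum f S) \<le> (\<Sum>i\<in>S. p (f i))" if "finite S" for f and S :: "'a set"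
    using that
  proof (induction S rule: finite_induct)
    case empty
    show ?case using z[of 0] by simp
  next
    case (insert x F)
    then show ?case using tr[of "f x" "sum f F"] by simp
  qed
  have up: "p x \<le> K * norm x" for x
  proof -
    have "p x = p (\<Sum>b\<in>Basis. (x \<bullet> b) *\<^sub>R b)"
      by (simp add: euclidean_representation)
    also have "\<dots> \<le> (\<Sum>b\<in>Basis. \<bar>x \<bullet> b\<bar> * p b)"
      using sumle[of Basis "\<lambda>b. (x \<bullet> b) *\<^sub>R b"] by (simp add: sc)
    also have "\<dots> \<le> (\<Sum>b\<in>Basis. norm x * p b)"
      by (intro sum_mono mult_right_mono Basis_le_norm nn)
    finally show ?thesis by (simp add: K_def sum_distrib_left mult.commute)
  qed
  have K0: "0 \<le> K" unfolding K_def by (intro sum_nonneg nn)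
  have sym: "p (x - y) = p (y - x)" for x y
    using sc[of "-1" "x - y"] by simp
  have lip: "\<bar>p x - p y\<bar> \<le> K * norm (x - y)" for x y
    using tr[of "x - y" y] tr[of "y - x" x] sym[of x y] up[of "x - y"] by simp
  have cont: "continuous_on UNIV p"
    by (rule lipschitz_on_continuous_on[of K])
       (use lip K0 in \<open>auto simp: lipschitz_on_def dist_norm\<close>)
  have ne: "sphere (0::'a) 1 \<noteq> {}" by simp
  obtain u where u: "u \<in> sphere 0 1" "\<And>y. y \<in> sphere 0 1 \<Longrightarrow> p u \<le> p y"
    using continuous_attains_inf[OF compact_sphere ne continuous_on_subset[OF cont]] by auto
  have "u \<noteq> 0" using u(1) by auto
  then have "p u > 0" using nn[of u] z[of u] by linarith
  moreover have "p u * norm x \<le> p x" for x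
  proof (cases "x = 0")
    case True
    then show ?thesis using nn[of x] by simp
  next
    case False
    then have "p u \<le> p ((1 / norm x) *\<^sub>R x)" by (intro u(2)) simp
    also have "\<dots> = p x / norm x" by (simp add: sc)
    finally show ?thesis using False by (simp add: field_simps)
  qed
  ultimately show thesis by (rule that)
qed

lemma full_rank_lattice_finite_bounded:
  fixes L :: "'a::euclidean_space set"
  assumes "full_rank_lattice L"
  shows "finite {l \<in> L. norm l \<le> R}"
proof -
  obtain B where B: "independent B" "span B = UNIV"
    and L: "L = range (\<lambda>c :: 'a \<Rightarrow> int. \<Sum>b\<in>B. of_int (c b) *\<^sub>R b)"
    using assms unfolding full_rank_lattice_def by blast
  have fB: "finite B" using B(1) independent_bound by blast
  have "\<exists>K. \<forall>x. \<bar>representation B x b\<bar> \<le> K * norm x" for b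
  proof -
    have "linear (\<lambda>x. representation B x b)"
      by (intro linearI) (simp_all add: representation_add representation_scale B)
    then show ?thesis
      using linear_bounded[of "\<lambda>x. representation B x b"] by auto
  qed
  then obtain K where K: "\<And>b x. \<bar>representation B x b\<bar> \<le> K b * norm x"
    by metis
  define M where "M = (\<Sum>b\<in>B. \<lceil>\<bar>K b\<bar> * \<bar>R\<bar>\<rceil>)"
  have M: "\<lceil>\<bar>K b\<bar> * \<bar>R\<bar>\<rceil> \<le> M" if "b \<in> B" for b
    unfolding M_def
  proof (rule member_le_sum[OF that])
    fix x
    have "0 \<le> \<bar>K x\<bar> * \<bar>R\<bar>" by simp
    then show "0 \<le> \<lceil>\<bar>K x\<bar> * \<bar>R\<bar>\<rceil>" by linarith
  qed (rule fB)
  have "{l \<in> L. norm l \<le> R} \<subseteq>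
        (\<lambda>c. \<Sum>b\<in>B. of_int (c b) *\<^sub>R b) ` (B \<rightarrow>\<^sub>E {-M..M})"
  proof
    fix l assume l: "l \<in> {l \<in> L. norm l \<le> R}"
    then obtain c :: "'a \<Rightarrow> int" where c: "l = (\<Sum>b\<in>B. of_int (c b) *\<^sub>R b)"
      using L by auto
    have "c b \<in> {-M..M}" if b: "b \<in> B" for b
    proof -
      have "representation B l b = (\<Sum>i\<in>B. of_int (c i) * representation B i b)"
        unfolding c by (simp add: representation_sum representation_scale B)
      also have "\<dots> = (\<Sum>i\<in>B. if i = b then of_int (c i) else 0)"
        by (intro sum.cong refl) (simp add: representation_basis B)
      also have "\<dots> = of_int (c b)" using b fB by simp
      finally have "\<bar>of_int (c b) :: real\<bar> \<le> K b * norm l" using K[where b = b and x = l] by simp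
      also have "\<dots> \<le> \<bar>K b\<bar> * \<bar>R\<bar>" using l by (intro mult_mono) auto
      also have "\<dots> \<le> of_int M" using M[OF b] by (simp add: ceiling_le_iff)
      finally show ?thesis by auto
    qed
    then show "l \<in> (\<lambda>c. \<Sum>b\<in>B. of_int (c b) *\<^sub>R b) ` (B \<rightarrow>\<^sub>E {-M..M})"
      by (intro image_eqI[of _ _ "restrict c B"]) (auto simp: c)
  qed
  then show ?thesis by (rule finite_subset) (auto intro: finite_PiE fB)
qed

lemma nn_dist_is_minimum:
  fixes p :: "'a::euclidean_space \<Rightarrow> real"
  assumes p: "is_norm p" and L: "full_rank_lattice L" and n: "n \<in> {1..N}"
  shows "nn_dist p \<alpha> L N n \<in> nn_dists p \<alpha> L N n"
    and "\<And>d. d \<in> nn_dists p \<alpha> L N n \<Longrightarrow> nn_dist p \<alpha> L N n \<le> d"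
proof -
  let ?S = "nn_dists p \<alpha> L N n"
  let ?v = "\<lambda>m l. real n *\<^sub>R \<alpha> - real m *\<^sub>R \<alpha> - l"
  obtain c where c: "c > 0" "\<And>x. c * norm x \<le> p x"
    using is_norm_lower_bound[OF p] by blast
  obtain B where B: "independent B" "span B = UNIV"
    and LB: "L = range (\<lambda>c :: 'a \<Rightarrow> int. \<Sum>b\<in>B. of_int (c b) *\<^sub>R b)"
    using L unfolding full_rank_lattice_def by blast
  have fB: "finite B" using B(1) independent_bound by blast
  have "B \<noteq> {}"
  proof
    assume "B = {}"
    then have "(UNIV :: 'a set) = {0}" using B(2) by simp
    then show False using nonempty_Basis nonzero_Basis by blast
  qed
  then obtain b where b: "b \<in> B" by blast
  have "b \<noteq> 0" using b B(1) dependent_zero by blast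
  moreover have "b \<in> L"
  proof -
    have "b = (\<Sum>i\<in>B. of_int (if i = b then 1 else 0) *\<^sub>R i)"
      using b fB by (simp add: if_distrib[of of_int] if_distrib[of "\<lambda>x. x *\<^sub>R _"] cong: if_cong)
    then show ?thesis unfolding LB by (rule range_eqI[where x = "\<lambda>i. if i = b then 1 else 0"])
  qed
  ultimately have "p (?v n b) \<in> ?S"
    unfolding nn_dists_def using n by (intro CollectI exI[of _ n] exI[of _ b]) auto
  then obtain d0 where d0: "d0 \<in> ?S" by blast
  define R where "R = d0 / c + real n * norm \<alpha> + real N * norm \<alpha>"
  have sub: "{d \<in> ?S. d \<le> d0} \<subseteq> (\<lambda>(m, l). p (?v m l)) ` ({1..N} \<times> {l \<in> L. norm l \<le> R})"
  proof
    fix d assume "d \<in> {d \<in> ?S. d \<le> d0}"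
    then obtain m l where d: "d = p (?v m l)" "m \<in> {1..N}" "l \<in> L" "d \<le> d0"
      unfolding nn_dists_def by auto
    have "norm (?v m l) \<le> d0 / c"
      using c(2)[of "?v m l"] d(1,4) c(1) by (simp add: field_simps)
    moreover have "norm (real m *\<^sub>R \<alpha>) \<le> real N * norm \<alpha>"
      using d(2) by (simp add: mult_right_mono)
    moreover have "norm l \<le> norm (real n *\<^sub>R \<alpha>) + norm (real m *\<^sub>R \<alpha>) + norm (?v m l)"
      using norm_triangle_ineq4[of "real n *\<^sub>R \<alpha> - real m *\<^sub>R \<alpha>" "?v m l"]
        norm_triangle_ineq4[of "real n *\<^sub>R \<alpha>" "real m *\<^sub>R \<alpha>"] by simp
    ultimately have "norm l \<le> R" unfolding R_def by simp
    then show "d \<in> (\<lambda>(m, l). p (?v m l)) ` ({1..N} \<times> {l \<in> L. norm l \<le> R})"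
      using d by (intro image_eqI[of _ _ "(m, l)"]) auto
  qed
  let ?F = "{d \<in> ?S. d \<le> d0}"
  have fin: "finite ?F"
    by (rule finite_subset[OF sub]) (intro finite_imageI finite_cartesian_product
        full_rank_lattice_finite_bounded[OF L] finite_atLeastAtMost)
  have Fne: "?F \<noteq> {}" using d0 by auto
  have mem: "Min ?F \<in> ?S" using Min_in[OF fin Fne] by simp
  have min: "Min ?F \<le> d" if "d \<in> ?S" for d
  proof (cases "d \<le> d0")
    case True
    then show ?thesis using that fin by (intro Min_le) auto
  next
    case False
    moreover have "Min ?F \<le> d0" using Min_in[OF fin Fne] by simp
    ultimately show ?thesis by simp
  qed
  have eq: "nn_dist p \<alpha> L N n = Min ?F"
    unfolding nn_dist_def by (rule Least_equality) (use mem min in auto)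
  show "nn_dist p \<alpha> L N n \<in> ?S" unfolding eq by (rule mem)
  show "\<And>d. d \<in> ?S \<Longrightarrow> nn_dist p \<alpha> L N n \<le> d" unfolding eq by (rule min)
qed

end

theory Submission
  imports Defs
begin

text \<open>
  A displacement \<open>n\<alpha> - m\<alpha> - \<ell>\<close> is the image \<open>\<phi> u\<close> of an integer triple \<open>u\<close>: its first coordinate, the
  height, is \<open>n - m\<close>, and the other two are the coordinates of \<open>\<ell>\<close> in a basis of \<open>L\<close>. Since
  \<open>\<phi> (-u) = -\<phi> u\<close>, the distance \<open>\<delta>\<^sub>n\<close> is the least nonzero norm \<open>p (\<phi> u)\<close> among heights of
  absolute value at most \<open>max (n - 1) (N - n)\<close>, a number between \<open>K = N div 2\<close> and \<open>2K\<close>. Let \<open>R\<close> be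
  the largest distance. Nonzero triples of height at most \<open>K\<close> have norm at least \<open>R\<close>, and each
  of the other distances is the norm of a triple whose height lies in \<open>(K, 2K]\<close>, different
  distances having different heights. It remains to show that there are no five triples
  of norm below \<open>R\<close> at distinct heights in \<open>(K, 2K]\<close> (\<open>no_five_short_vectors\<close>).

  Suppose there are five. The gain comes from halving. If a sum of the triples with signs
  has only even coordinates and height at most \<open>2K\<close>, then half of it is a triple of height at most
  \<open>K\<close>, so the sum has norm at least \<open>2R\<close> or vanishes. Applied to \<open>w - w'\<close> and to \<open>w\<close> this
  shows that the five triples lie in distinct nonzero classes modulo 2. Any five points of
  the Fano plane contain two lines \<open>{s, x, y}\<close> and \<open>{s, z, t}\<close> meeting in one point
  (\<open>two_fano_lines\<close>), and three triples on a line have an even sum. If \<open>i\<close> is the lowest of them,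
  then \<open>i + j - k\<close> and \<open>i + k - j\<close> have height at most \<open>2K\<close>, hence norm at least \<open>2R\<close>, which
  makes \<open>i + j\<close> and \<open>i + k\<close> longer than all five vectors. All differences are longer too, so \<open>i\<close> is
  \<open>apart\<close> from \<open>j\<close> and \<open>k\<close>.

  The rest is plane geometry. A vector can be apart from at most two others (\<open>no_apart_claw\<close>).
  So \<open>s\<close> is the lowest point of neither line. Say \<open>y\<close> and \<open>t\<close> are the lowest points. Each of them has
  used up its two partners, which forces \<open>y + z\<close> and \<open>x + t\<close> to be short.
  The even vector \<open>y + z - x - t\<close> then has norm below \<open>2R\<close>, hence vanishes. So
  \<open>y - x = t - z\<close>, and \<open>parallelogram_diagonal_short\<close> says that this difference is short, although
  differences of the five vectors are long.
\<close>

section \<open>Planar vectors that are far apart up to sign\<close>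

lemma is_normD:
  assumes "is_norm p"
  shows "0 \<le> p x" "p (c *\<^sub>R x) = \<bar>c\<bar> * p x" "p (x + y) \<le> p x + p y"
    "p (- x) = p x" "p (x - y) = p (y - x)" "p 0 = 0"
    "p (x - y) \<le> p x + p y"
proof -
  show sc: "p (c *\<^sub>R x) = \<bar>c\<bar> * p x" for c x
    using assms unfolding is_norm_def by blast
  show tri: "p (x + y) \<le> p x + p y" for x y
    using assms unfolding is_norm_def by blast
  show "0 \<le> p x" "p 0 = 0"
    using assms unfolding is_norm_def by blast+
  show neg: "p (- x) = p x" for x using sc[of "-1" x] by simp
  show "p (x - y) = p (y - x)" using neg[of "x - y"] by simp
  show "p (x - y) \<le> p x + p y" using tri[of x "- y"] neg[of y] by simp
qed

lemma norm_le_of_convex_relation: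
  assumes p: "is_norm p" and eq: "g *\<^sub>R x = a *\<^sub>R u + b *\<^sub>R v + c *\<^sub>R w"
    and "0 < g" "0 \<le> a" "0 \<le> b" "0 \<le> c" and sum: "a + b + c \<le> g"
    and bounds: "p u \<le> r" "p v \<le> r" "p w \<le> r"
  shows "p x \<le> r"
proof -
  have r: "0 \<le> r" using bounds(1) is_normD(1)[OF p, of u] by linarith
  have "g * p x = p (a *\<^sub>R u + b *\<^sub>R v + c *\<^sub>R w)"
    using is_normD(2)[OF p, of g x] \<open>0 < g\<close> by (simp add: eq)
  also have "\<dots> \<le> a * p u + b * p v + c * p w"
    using is_normD(3)[OF p, of "a *\<^sub>R u + b *\<^sub>R v" "c *\<^sub>R w"]
      is_normD(3)[OF p, of "a *\<^sub>R u" "b *\<^sub>R v"] assms(4-6)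
    by (simp add: is_normD(2)[OF p])
  also have "\<dots> \<le> a * r + b * r + c * r"
    using assms by (intro add_mono mult_left_mono) auto
  also have "\<dots> = (a + b + c) * r" by (simp add: algebra_simps)
  also have "\<dots> \<le> g * r" using sum r by (rule mult_right_mono)
  finally show ?thesis using \<open>0 < g\<close> by simp
qed

text \<open>
  This replaces all use of angles. If \<open>a \<ge> b \<ge> \<bar>c\<bar>\<close>, solving the relation for \<open>a (x + y)\<close> leaves
  \<open>(a - b) y - c z\<close>, whose coefficients have total size at most \<open>a\<close>.
\<close>

lemma relation_forces_short_sum:
  assumes p: "is_norm p" and eq: "a *\<^sub>R x + b *\<^sub>R y + c *\<^sub>R z = 0"
    and small: "\<bar>c\<bar> \<le> \<bar>a\<bar>" "\<bar>c\<bar> \<le> \<bar>b\<bar>" and nz: "a \<noteq> 0 \<or> b \<noteq> 0"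
    and sign: "0 \<le> a * b"
    and bounds: "p x \<le> r" "p y \<le> r" "p z \<le> r"
  shows "p (x + y) \<le> r"
proof -
  have main: "p (x + y) \<le> r"
    if eq: "a *\<^sub>R x + b *\<^sub>R y + c *\<^sub>R z = 0" and "0 < a" "0 \<le> b" "b \<le> a" "\<bar>c\<bar> \<le> b"
      and "p x \<le> r" "p y \<le> r" for a b c x y
  proof (rule norm_le_of_convex_relation[OF p _ \<open>0 < a\<close>])
    have "c *\<^sub>R z = - (a *\<^sub>R x + b *\<^sub>R y)" using eq by (simp add: eq_neg_iff_add_eq_0 algebra_simps)
    then show "a *\<^sub>R (x + y) = (a - b) *\<^sub>R y + \<bar>c\<bar> *\<^sub>R (- (sgn c *\<^sub>R z)) + 0 *\<^sub>R 0"
      by (simp add: algebra_simps abs_mult_sgn)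
    have "\<bar>sgn c\<bar> * p z \<le> 1 * p z"
      by (intro mult_right_mono is_normD(1)[OF p]) (simp add: sgn_if)
    then show "p (- (sgn c *\<^sub>R z)) \<le> r"
      using bounds(3) unfolding is_normD(4)[OF p] is_normD(2)[OF p] by linarith
    show "p 0 \<le> r" using bounds(1) is_normD(1)[OF p, of x] is_normD(6)[OF p] that(6) by simp
  qed (use that in auto)
  have both: "p (x + y) \<le> r" if eq: "a *\<^sub>R x + b *\<^sub>R y + c *\<^sub>R z = 0"
    and "0 \<le> a" "0 \<le> b" "\<bar>c\<bar> \<le> a" "\<bar>c\<bar> \<le> b" "a \<noteq> 0 \<or> b \<noteq> 0" for a b c
  proof (cases "b \<le> a")
    case True
    then show ?thesis using main[OF eq] that bounds by linarith
  next
    case False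
    then show ?thesis using main[of b y a x c] that bounds by (simp add: add.commute)
  qed
  show ?thesis
  proof (cases "0 \<le> a \<and> 0 \<le> b")
    case True
    then show ?thesis using both[OF eq] small nz by simp
  next
    case False
    then have "a \<le> 0" "b \<le> 0" using sign by (auto simp: zero_le_mult_iff)
    moreover have "(- a) *\<^sub>R x + (- b) *\<^sub>R y + (- c) *\<^sub>R z
        = - (a *\<^sub>R x + b *\<^sub>R y + c *\<^sub>R z)" by simp
    ultimately show ?thesis using both[of "- a" "- b" "- c"] eq small nz by simp
  qed
qed

text \<open>
  The condition does not change when one of the vectors is negated; it is the normed-plane
  substitute for two lines through the origin that form a large angle.
\<close>

definition apart :: "('a::real_vector \<Rightarrow> real) \<Rightarrow> real \<Rightarrow> 'a \<Rightarrow> 'a \<Rightarrow> bool" where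
  "apart p r x y \<longleftrightarrow> r < p (x - y) \<and> r < p (x + y)"

lemma apart_sym:
  assumes "is_norm p"
  shows "apart p r x y \<longleftrightarrow> apart p r y x"
  unfolding apart_def by (simp add: is_normD(5)[OF assms, of x y] add.commute)

text \<open>
  The usable form of the previous estimate: in a linear relation between three short vectors,
  the two with the largest coefficients are not apart, and the sign of the product of these
  coefficients tells which of their sum and difference is short.
\<close>

lemma not_apart_if_dominant:
  assumes p: "is_norm p" and eq: "a *\<^sub>R x + b *\<^sub>R y + c *\<^sub>R z = 0"
    and small: "\<bar>c\<bar> \<le> \<bar>a\<bar>" "\<bar>c\<bar> \<le> \<bar>b\<bar>" and nz: "a \<noteq> 0 \<or> b \<noteq> 0"
    and bounds: "p x \<le> r" "p y \<le> r" "p z \<le> r"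
  shows "\<not> apart p r x y" and "a * b \<le> 0 \<Longrightarrow> p (x - y) \<le> r"
proof -
  show diff: "p (x - y) \<le> r" if "a * b \<le> 0"
    using relation_forces_short_sum[OF p, of a x "- b" "- y" c z r] that assms
    by (simp add: is_normD(4)[OF p])
  show "\<not> apart p r x y"
    using diff relation_forces_short_sum[OF p eq small nz _ bounds]
    unfolding apart_def by (meson linear not_less)
qed

definition cross :: "real ^ 2 \<Rightarrow> real ^ 2 \<Rightarrow> real" where
  "cross u v = u $ 1 * v $ 2 - u $ 2 * v $ 1"

lemma cross_relation: "cross v w *\<^sub>R u + cross w u *\<^sub>R v + cross u v *\<^sub>R w = 0"
  by (simp add: vec_eq_iff forall_2 cross_def algebra_simps)

lemma cross_swap: "cross u v = - cross v u"
  by (simp add: cross_def)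

lemma cross_nonzero_if_apart:
  fixes x y :: "real ^ 2"
  assumes p: "is_norm p" and bounds: "p x \<le> r" "p y \<le> r" and far: "apart p r x y"
  shows "cross x y \<noteq> 0"
proof
  assume 0: "cross x y = 0"
  have "x \<noteq> 0" using far bounds by (auto simp: apart_def)
  then obtain i where i: "x $ i \<noteq> 0" by (auto simp: vec_eq_iff)
  have rel: "(y $ i) *\<^sub>R x + (- (x $ i)) *\<^sub>R y + 0 *\<^sub>R x = 0"
    using 0 exhaust_2[of i] by (auto simp: vec_eq_iff forall_2 cross_def algebra_simps)
  show False using not_apart_if_dominant(1)[OF p rel] i bounds far by auto
qed

text \<open>
  In the relation between \<open>s\<close>, \<open>y\<close>, \<open>t\<close> whose coefficients are the cross products, \<open>s\<close> cannot be
  one of the two dominant vectors, as it is apart from both others. So \<open>y\<close> and \<open>t\<close> are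
  dominant, and their coefficients have equal signs because their difference is long. That
  the signs agree means that \<open>y\<close> and \<open>t\<close> lie on different sides of the line through \<open>s\<close>.
\<close>

lemma apart_neighbours_on_opposite_sides:
  fixes s y t :: "real ^ 2"
  assumes p: "is_norm p" and bounds: "p s \<le> r" "p y \<le> r" "p t \<le> r"
    and sy: "apart p r s y" and st: "apart p r s t" and yt: "r < p (y - t)"
  shows "0 < cross t s * cross s y"
    and "\<bar>cross y t\<bar> < \<bar>cross t s\<bar>" and "\<bar>cross y t\<bar> < \<bar>cross s y\<bar>"
proof -
  let ?a = "cross y t" and ?b = "cross t s" and ?c = "cross s y"
  have rel: "?a *\<^sub>R s + ?b *\<^sub>R y + ?c *\<^sub>R t = 0" by (rule cross_relation)
  have rel': "?a *\<^sub>R s + ?c *\<^sub>R t + ?b *\<^sub>R y = 0" "?b *\<^sub>R y + ?c *\<^sub>R t + ?a *\<^sub>R s = 0"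
    using rel by (simp_all add: add_ac)
  have nz: "?b \<noteq> 0" "?c \<noteq> 0"
    using cross_nonzero_if_apart[OF p] bounds sy st cross_swap[of t s] by auto
  have "\<not> (\<bar>?c\<bar> \<le> \<bar>?a\<bar> \<and> \<bar>?c\<bar> \<le> \<bar>?b\<bar>)" "\<not> (\<bar>?b\<bar> \<le> \<bar>?a\<bar> \<and> \<bar>?b\<bar> \<le> \<bar>?c\<bar>)"
    using not_apart_if_dominant(1)[OF p rel] not_apart_if_dominant(1)[OF p rel'(1)]
      nz bounds sy st by blast+
  then show lt: "\<bar>?a\<bar> < \<bar>?b\<bar>" "\<bar>?a\<bar> < \<bar>?c\<bar>" by linarith+
  have "\<not> ?b * ?c \<le> 0"
    using not_apart_if_dominant(2)[OF p rel'(2)] lt nz bounds yt by fastforce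
  then show "0 < ?b * ?c" by simp
qed

text \<open>A line has only two sides.\<close>

lemma no_apart_claw:
  fixes s x y z :: "real ^ 2"
  assumes p: "is_norm p" and bounds: "p s \<le> r" "p x \<le> r" "p y \<le> r" "p z \<le> r"
    and "apart p r s x" "apart p r s y" "apart p r s z"
    and "r < p (x - y)" "r < p (y - z)" "r < p (x - z)"
  shows False
proof -
  have "cross s u * cross s v < 0"
    if "p u \<le> r" "p v \<le> r" "apart p r s u" "apart p r s v" "r < p (u - v)" for u v
    using apart_neighbours_on_opposite_sides(1)[OF p bounds(1) that] cross_swap[of v s]
    by (simp add: mult.commute)
  then have "cross s x * cross s y < 0" "cross s y * cross s z < 0" "cross s x * cross s z < 0"
    using assms by blast+
  then show False by (auto simp: mult_less_0_iff)
qed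

text \<open>
  In the coordinates given by \<open>y\<close> and \<open>t\<close>, the point \<open>e\<close> lies in the triangle spanned by its left
  neighbour, its lower neighbour and a point to the upper right of it.
\<close>

lemma corner_short:
  assumes p: "is_norm p" and "0 \<le> i" "0 \<le> j"
    and "p (e - y) \<le> r" "p (e - t) \<le> r" "p (e + i *\<^sub>R y + j *\<^sub>R t) \<le> r"
  shows "p e \<le> r"
  by (rule norm_le_of_convex_relation[OF p, of "1 + i + j" e i "e - y" j "e - t"
        1 "e + i *\<^sub>R y + j *\<^sub>R t"])
    (use assms in \<open>auto simp: algebra_simps\<close>)

text \<open>
  In the coordinates given by \<open>y\<close> and \<open>t\<close>, the segment from \<open>t = (0, 1)\<close> to \<open>e - y = (a - 1, b)\<close> meets
  the horizontal line through \<open>s = (\<alpha>, \<beta>)\<close>. The hypothesis \<open>side\<close> says that this happens at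
  distance at least 1 to the left of \<open>s\<close>. So \<open>s - y\<close> lies between two short points of that
  horizontal line.
\<close>

lemma slide_short:
  assumes p: "is_norm p" and s: "s = \<alpha> *\<^sub>R y + \<beta> *\<^sub>R t" and e: "e = a *\<^sub>R y + b *\<^sub>R t"
    and \<beta>: "1 < \<beta>" "\<beta> \<le> b" and side: "(a - 1) * (\<beta> - 1) \<le> (\<alpha> - 1) * (b - 1)"
    and "p s \<le> r" "p t \<le> r" "p (e - y) \<le> r"
  shows "p (s - y) \<le> r"
proof -
  \<comment> \<open>The horizontal distance from \<open>s\<close> to the segment, multiplied by \<open>b - 1\<close> to clear denominators.\<close>
  define g where "g = \<alpha> * (b - 1) - (\<beta> - 1) * (a - 1)"
  have g: "b - 1 \<le> g" using side by (simp add: g_def algebra_simps)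
  have "g *\<^sub>R (s - y) = (g - (b - 1)) *\<^sub>R s + (b - \<beta>) *\<^sub>R t + (\<beta> - 1) *\<^sub>R (e - y)"
  proof -
    have "g * (\<alpha> - 1) = (g - (b - 1)) * \<alpha> + (\<beta> - 1) * (a - 1)"
      "g * \<beta> = (g - (b - 1)) * \<beta> + (b - \<beta>) + (\<beta> - 1) * b"
      unfolding g_def by algebra+
    moreover have "g *\<^sub>R (s - y) = (g * (\<alpha> - 1)) *\<^sub>R y + (g * \<beta>) *\<^sub>R t"
      by (simp add: s algebra_simps)
    moreover have "(g - (b - 1)) *\<^sub>R s + (b - \<beta>) *\<^sub>R t + (\<beta> - 1) *\<^sub>R (e - y)
        = ((g - (b - 1)) * \<alpha> + (\<beta> - 1) * (a - 1)) *\<^sub>R y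
          + ((g - (b - 1)) * \<beta> + (b - \<beta>) + (\<beta> - 1) * b) *\<^sub>R t"
      by (simp add: s e algebra_simps)
    ultimately show ?thesis by simp
  qed
  then show ?thesis
    by (rule norm_le_of_convex_relation[OF p]) (use g \<beta> assms in auto)
qed

text \<open>
  Suppose that \<open>y\<close> and \<open>t\<close> are independent. Since \<open>s\<close> is apart from them, its coordinates with
  respect to them both exceed 1, up to a common sign. The point \<open>s\<close> is short but \<open>s - y\<close> and \<open>s - t\<close> are not. By \<open>slide_short\<close>, with \<open>y\<close> and
  \<open>t\<close> in either role, this keeps \<open>s\<close> to the upper right of \<open>e\<close>, and \<open>corner_short\<close> applies.
\<close>

lemma parallelogram_diagonal_short:
  fixes s y t e :: "real ^ 2"
  assumes p: "is_norm p" and bounds: "p s \<le> r" "p y \<le> r" "p t \<le> r"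
    and sy: "apart p r s y" and st: "apart p r s t" and yt: "r < p (y - t)"
    and ey: "p (e - y) \<le> r" and et: "p (e - t) \<le> r"
  shows "p e \<le> r"
proof -
  note sides = apart_neighbours_on_opposite_sides[OF p bounds sy st yt]
  show ?thesis
  proof (cases "cross y t = 0")
    \<comment> \<open>Here \<open>y\<close> and \<open>t\<close> point in opposite directions, so \<open>e\<close> lies between \<open>e - y\<close> and \<open>e - t\<close>.\<close>
    case True
    let ?i = "\<bar>cross t s\<bar>" and ?j = "\<bar>cross s y\<bar>"
    have "cross t s *\<^sub>R y + cross s y *\<^sub>R t = 0"
      using cross_relation[of y t s] True by simp
    then have "?i *\<^sub>R y + ?j *\<^sub>R t = 0"
      using sides(1) by (cases "0 < cross t s")
        (auto simp: zero_less_mult_iff abs_if neg_eq_iff_add_eq_0 add_eq_0_iff)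
    then have "(?i + ?j) *\<^sub>R e = ?i *\<^sub>R (e - y) + ?j *\<^sub>R (e - t) + 0 *\<^sub>R y"
      by (simp add: algebra_simps)
    then show ?thesis
      by (rule norm_le_of_convex_relation[OF p]) (use sides True ey et bounds in auto)
  next
    case False
    define D where "D = cross y t"
    have D: "D \<noteq> 0" using False by (simp add: D_def)
    have expand: "w = (cross w t / D) *\<^sub>R y + (cross y w / D) *\<^sub>R t" for w
    proof -
      have "D *\<^sub>R w = cross w t *\<^sub>R y + cross y w *\<^sub>R t"
        by (simp add: D_def vec_eq_iff forall_2 cross_def algebra_simps)
      then have "(1 / D) *\<^sub>R (D *\<^sub>R w) = (1 / D) *\<^sub>R (cross w t *\<^sub>R y + cross y w *\<^sub>R t)" by simp
      then show ?thesis using D by (simp add: algebra_simps)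
    qed
    obtain a b where e: "e = a *\<^sub>R y + b *\<^sub>R t" using expand by blast
    \<comment> \<open>The hypotheses on \<open>s\<close> also hold for \<open>-s\<close>, so its coordinates may be taken positive.\<close>
    obtain s' \<alpha> \<beta> where s': "s' = \<alpha> *\<^sub>R y + \<beta> *\<^sub>R t" "1 < \<alpha>" "1 < \<beta>" "s' = s \<or> s' = - s"
    proof -
      define \<alpha> \<beta> where "\<alpha> = cross s t / D" and "\<beta> = cross y s / D"
      have "\<alpha> * \<beta> = cross t s * cross s y / D\<^sup>2"
        using cross_swap[of s t] cross_swap[of y s] by (simp add: \<alpha>_def \<beta>_def power2_eq_square)
      then have pos: "0 < \<alpha> * \<beta>" using sides(1) D by simp
      have "1 < \<bar>\<alpha>\<bar>" "1 < \<bar>\<beta>\<bar>"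
        using sides(2,3) D cross_swap[of s t] cross_swap[of y s]
        by (simp_all add: \<alpha>_def \<beta>_def D_def abs_divide)
      moreover have "s = \<alpha> *\<^sub>R y + \<beta> *\<^sub>R t" unfolding \<alpha>_def \<beta>_def by (rule expand)
      moreover from this have "- s = (- \<alpha>) *\<^sub>R y + (- \<beta>) *\<^sub>R t" by simp
      ultimately show thesis
        using that[of s \<alpha> \<beta>] that[of "- s" "- \<alpha>" "- \<beta>"] pos
        by (auto simp: zero_less_mult_iff abs_if split: if_splits)
    qed
    have s'p: "p s' \<le> r" using s'(4) bounds is_normD(4)[OF p] by auto
    have s'y: "r < p (s' - y)"
      using s'(4) sy is_normD(4)[OF p, of "s + y"] by (auto simp: apart_def)
    have s't: "r < p (s' - t)"
      using s'(4) st is_normD(4)[OF p, of "s + t"] by (auto simp: apart_def)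
    have no_right: "\<not> (\<beta> \<le> b \<and> (a - 1) * (\<beta> - 1) \<le> (\<alpha> - 1) * (b - 1))"
      using slide_short[OF p s'(1) e s'(3)] s'p bounds ey s'y by fastforce
    have no_left: "\<not> (\<alpha> \<le> a \<and> (b - 1) * (\<alpha> - 1) \<le> (\<beta> - 1) * (a - 1))"
      using slide_short[where y = t and t = y and s = s' and \<alpha> = \<beta> and a = b and b = a and e = e and r = r, OF p _ _ s'(2)] s'(1) e s'p bounds et s't
      by (fastforce simp: add.commute)
    \<comment> \<open>If \<open>b > \<beta>\<close>, then \<open>s\<close> must lie strictly to the left of the line through \<open>(1, 1)\<close> and \<open>(a, b)\<close>,
        which then forces \<open>a > \<alpha>\<close> and contradicts the mirrored statement.\<close>
    have "a \<le> \<alpha> \<and> b \<le> \<beta>"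
    proof (rule ccontr)
      assume "\<not> (a \<le> \<alpha> \<and> b \<le> \<beta>)"
      then consider "b > \<beta>" | "a > \<alpha>" by linarith
      then show False
      proof cases
        case 1
        then have left: "(\<alpha> - 1) * (b - 1) < (a - 1) * (\<beta> - 1)" using no_right by auto
        moreover have "(\<alpha> - 1) * (\<beta> - 1) < (\<alpha> - 1) * (b - 1)" using 1 s' by simp
        ultimately have "(\<alpha> - 1) * (\<beta> - 1) < (a - 1) * (\<beta> - 1)" by linarith
        then have "\<alpha> < a" using s' by (simp add: mult_less_cancel_right)
        then show False using no_left left by (simp add: mult.commute)
      next
        case 2
        then have right: "(\<beta> - 1) * (a - 1) < (b - 1) * (\<alpha> - 1)" using no_left by auto
        moreover have "(\<beta> - 1) * (\<alpha> - 1) < (\<beta> - 1) * (a - 1)" using 2 s' by simp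
        ultimately have "(\<beta> - 1) * (\<alpha> - 1) < (b - 1) * (\<alpha> - 1)" by linarith
        then have "\<beta> < b" using s' by (simp add: mult_less_cancel_right)
        then show False using no_right right by (simp add: mult.commute)
      qed
    qed
    then show ?thesis
      using corner_short[OF p, of "\<alpha> - a" "\<beta> - b" e y r t] ey et s'p
      by (simp add: s'(1) e algebra_simps)
  qed
qed

section \<open>Parity classes of integer triples\<close>

type_synonym int3 = "int \<times> int \<times> int"

definition parity :: "int3 \<Rightarrow> bool \<times> bool \<times> bool" where
  "parity u = (odd (fst u), odd (fst (snd u)), odd (snd (snd u)))"

text \<open>The addition of the vector space \<open>F\<^sub>2\<^sup>3\<close>, whose nonzero vectors are the points of the Fano plane.\<close>

definition xor3 :: "bool \<times> bool \<times> bool \<Rightarrow> bool \<times> bool \<times> bool \<Rightarrow> bool \<times> bool \<times> bool" where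
  "xor3 a b = (fst a \<noteq> fst b, fst (snd a) \<noteq> fst (snd b), snd (snd a) \<noteq> snd (snd b))"

abbreviation zero3 :: "bool \<times> bool \<times> bool" where
  "zero3 \<equiv> (False, False, False)"

lemma parity_add: "parity (u + v) = xor3 (parity u) (parity v)"
  and parity_diff: "parity (u - v) = xor3 (parity u) (parity v)"
  by (auto simp: parity_def xor3_def)

lemma xor3_eq_zero_iff: "xor3 a b = zero3 \<longleftrightarrow> a = b"
  and xor3_eq_left_iff: "xor3 a b = a \<longleftrightarrow> b = zero3"
  and xor3_eq_right_iff: "xor3 a b = b \<longleftrightarrow> a = zero3"
  and xor3_eq_iff: "xor3 a b = c \<longleftrightarrow> a = xor3 b c"
  and xor3_cancel: "xor3 (xor3 a b) a = b" "xor3 (xor3 a b) b = a"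
  and xor3_right_cancel: "xor3 a c = xor3 b c \<longleftrightarrow> a = b"
  by (auto simp: xor3_def prod_eq_iff)

lemma half_of_even:
  assumes "parity u = zero3"
  obtains v where "u = v + v"
proof
  show "u = (fst u div 2, fst (snd u) div 2, snd (snd u) div 2)
      + (fst u div 2, fst (snd u) div 2, snd (snd u) div 2)"
    using assms by (auto simp: parity_def prod_eq_iff)
qed

text \<open>
  The complement of the five points consists of two points \<open>m\<close>, \<open>n\<close>. Their line has a third point
  \<open>s\<close>, which is one of the five, and the two other lines through \<open>s\<close> avoid \<open>m\<close> and \<open>n\<close>.
\<close>

lemma two_fano_lines:
  fixes A :: "(bool \<times> bool \<times> bool) set"
  assumes "card A = 5" "zero3 \<notin> A"
  obtains s x z where "s \<in> A" "x \<in> A" "xor3 x s \<in> A" "z \<in> A" "xor3 z s \<in> A"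
    "distinct [s, x, xor3 x s, z, xor3 z s]"
proof -
  have "card (UNIV :: (bool \<times> bool \<times> bool) set) = 8"
    by (simp flip: UNIV_Times_UNIV add: card_cartesian_product)
  then have "card (UNIV - insert zero3 A) = 2"
    using assms by (subst card_Diff_subset) auto
  then obtain m n where mn: "UNIV - insert zero3 A = {m, n}" "m \<noteq> n"
    by (meson card_2_iff)
  have A: "v \<in> A \<longleftrightarrow> v \<noteq> zero3 \<and> v \<noteq> m \<and> v \<noteq> n" for v using mn assms by blast
  have mn0: "m \<noteq> zero3" "n \<noteq> zero3" using mn(1) by blast+
  define s where "s = xor3 m n"
  have s: "s \<in> A" "s \<noteq> zero3"
    using mn0 mn(2) unfolding A s_def
    by (simp_all add: xor3_eq_zero_iff xor3_eq_left_iff xor3_eq_right_iff)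
  have line: "xor3 v s \<in> A \<and> xor3 v s \<noteq> s \<and> xor3 v s \<noteq> v" if "v \<in> A" "v \<noteq> s" for v
  proof -
    have "xor3 v s \<noteq> m" "xor3 v s \<noteq> n"
      using that(1) unfolding A s_def xor3_eq_iff[of v] by (auto simp: xor3_cancel)
    then show ?thesis
      using that s unfolding A by (simp add: xor3_eq_zero_iff xor3_eq_left_iff xor3_eq_right_iff)
  qed
  have "A - {s} \<noteq> {}" using assms(1) s card_Diff_singleton[of s A] by force
  then obtain x where x: "x \<in> A" "x \<noteq> s" by blast
  have "card (A - {s, x, xor3 x s}) = 2"
    using assms(1) s x line[OF x] by (subst card_Diff_subset) auto
  then have "A - {s, x, xor3 x s} \<noteq> {}" by (metis card.empty zero_neq_numeral)
  then obtain z where z: "z \<in> A" "z \<noteq> s" "z \<noteq> x" "z \<noteq> xor3 x s" by blast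
  have "xor3 z s \<noteq> x" "xor3 z s \<noteq> xor3 x s"
    using z xor3_cancel(2)[of z s] by (auto simp: xor3_right_cancel)
  then show thesis using that[of s x z] s x z line[OF x] line[OF z(1,2)] by auto
qed

section \<open>At most four short vectors in a dyadic range of heights\<close>

text \<open>
  Halving gives information only for sums of height at most \<open>2K\<close>. A sum \<open>i + j - k\<close> of elements of
  \<open>W\<close> can have height almost \<open>3K\<close>, but it stays below the height of \<open>j\<close> when \<open>i\<close> is lower than \<open>k\<close>.
  This is why the lowest point of each line plays a special role.
\<close>

lemma no_five_short_vectors:
  fixes \<phi> :: "int3 \<Rightarrow> real ^ 2"
  assumes p: "is_norm p" and add: "\<And>u v. \<phi> (u + v) = \<phi> u + \<phi> v"
    and sparse: "\<And>u. u \<noteq> 0 \<Longrightarrow> \<bar>fst u\<bar> \<le> K \<Longrightarrow> R \<le> p (\<phi> u)"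
    and height: "\<And>w. w \<in> W \<Longrightarrow> K < fst w \<and> fst w \<le> 2 * K"
    and short: "\<And>w. w \<in> W \<Longrightarrow> p (\<phi> w) < R"
    and inj: "inj_on fst W"
  shows "card W \<noteq> 5"
proof
  assume card: "card W = 5"
  then have fin: "finite W" "W \<noteq> {}" by (auto intro: card_ge_0_finite)
  \<comment> \<open>The planar lemmas want a closed bound on the five norms.\<close>
  define r where "r = Max ((\<lambda>w. p (\<phi> w)) ` W)"
  have r: "p (\<phi> w) \<le> r" if "w \<in> W" for w using that fin by (auto simp: r_def)
  have rR: "r < R" unfolding r_def using fin short by simp
  obtain w0 where "w0 \<in> W" using fin by blast
  then have R: "0 < R" using short[of w0] is_normD(1)[OF p, of "\<phi> w0"] by linarith
  have diff: "\<phi> (u - v) = \<phi> u - \<phi> v" for u v using add[of "u - v" v] by simp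
  have half: "2 * R \<le> p (\<phi> u)" if even: "parity u = zero3" and "u \<noteq> 0" "\<bar>fst u\<bar> \<le> 2 * K" for u
  proof -
    obtain v where v: "u = v + v" using half_of_even[OF even] .
    have "v \<noteq> 0" "\<bar>fst v\<bar> \<le> K" using v that by auto
    then have "R \<le> p (\<phi> v)" by (rule sparse)
    moreover have "p (\<phi> u) = 2 * p (\<phi> v)"
      using is_normD(2)[OF p, of 2 "\<phi> v"] by (simp add: v add scaleR_2)
    ultimately show ?thesis by simp
  qed
  have far: "r < p (\<phi> v - \<phi> w)" if "v \<in> W" "w \<in> W" "v \<noteq> w" for v w
  proof -
    have "v - w \<noteq> 0" "\<bar>fst (v - w)\<bar> \<le> K" using that height[of v] height[of w] by auto
    then have "R \<le> p (\<phi> (v - w))" by (rule sparse)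
    then show ?thesis using rR by (simp add: diff)
  qed
  have inj_parity: "inj_on parity W"
  proof
    fix v w assume vw: "v \<in> W" "w \<in> W" "parity v = parity w"
    show "v = w"
    proof (rule ccontr)
      assume "v \<noteq> w"
      then have "v - w \<noteq> 0" "\<bar>fst (v - w)\<bar> \<le> 2 * K" "parity (v - w) = zero3"
        using vw height[of v] height[of w] by (auto simp: parity_diff xor3_eq_zero_iff)
      then have "2 * R \<le> p (\<phi> v - \<phi> w)" using half[of "v - w"] by (simp add: diff)
      then show False
        using is_normD(7)[OF p, of "\<phi> v" "\<phi> w"] short[of v] short[of w] vw by simp
    qed
  qed
  have "parity w \<noteq> zero3" if "w \<in> W" for w
  proof
    assume even: "parity w = zero3"
    have "w \<noteq> 0" "\<bar>fst w\<bar> \<le> 2 * K" using height[OF that] by auto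
    then show False using half[OF even] short[OF that] R by linarith
  qed
  then have "card (parity ` W) = 5" "zero3 \<notin> parity ` W"
    using card_image[OF inj_parity] card by (simp, metis imageE)
  from two_fano_lines[OF this] obtain a b c
    where abc: "a \<in> parity ` W" "b \<in> parity ` W" "xor3 b a \<in> parity ` W" "c \<in> parity ` W"
      "xor3 c a \<in> parity ` W" "distinct [a, b, xor3 b a, c, xor3 c a]" .
  then obtain s x y z t where W: "s \<in> W" "x \<in> W" "y \<in> W" "z \<in> W" "t \<in> W"
    and lines: "parity y = xor3 (parity x) (parity s)" "parity t = xor3 (parity z) (parity s)"
    and "distinct [parity s, parity x, parity y, parity z, parity t]"
    by (elim imageE) simp
  then have dist: "distinct [s, x, y, z, t]" by auto
  let ?F = "\<lambda>v w. apart p r (\<phi> v) (\<phi> w)"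
  have sym: "?F v w \<longleftrightarrow> ?F w v" for v w by (rule apart_sym[OF p])
  have line_apart: "?F i j"
    if "i \<in> W" "j \<in> W" "k \<in> W" "parity (i + j - k) = zero3" "fst i < fst k" "i \<noteq> j" for i j k
  proof -
    have pos: "0 < fst (i + j - k)" "\<bar>fst (i + j - k)\<bar> \<le> 2 * K"
      using height[OF that(1)] height[OF that(2)] height[OF that(3)] that(5) by auto
    then have "i + j - k \<noteq> 0" by (metis fst_zero less_irrefl)
    then have "2 * R \<le> p (\<phi> i + \<phi> j - \<phi> k)"
      using half[OF that(4) _ pos(2)] by (simp add: add diff)
    moreover have "p (\<phi> i + \<phi> j - \<phi> k) \<le> p (\<phi> i + \<phi> j) + p (\<phi> k)"
      by (rule is_normD(7)[OF p])
    ultimately show ?thesis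
      using far[of i j] that r[of k] rR by (simp add: apart_def)
  qed
  have min_apart: "?F i j \<and> ?F i k \<or> ?F j i \<and> ?F j k \<or> ?F k i \<and> ?F k j"
    if "i \<in> W" "j \<in> W" "k \<in> W" "distinct [i, j, k]" "parity k = xor3 (parity j) (parity i)" for i j k
  proof -
    have even: "parity (i + j - k) = zero3" "parity (i + k - j) = zero3" "parity (j + k - i) = zero3"
      "parity (j + i - k) = zero3" "parity (k + i - j) = zero3" "parity (k + j - i) = zero3"
      using that(5) by (auto simp: parity_add parity_diff xor3_def prod_eq_iff)
    have "fst i \<noteq> fst j" "fst i \<noteq> fst k" "fst j \<noteq> fst k"
      using inj that by (auto dest: inj_onD)
    then consider "fst i < fst j" "fst i < fst k" | "fst j < fst i" "fst j < fst k"
      | "fst k < fst i" "fst k < fst j" by linarith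
    then show ?thesis
      using line_apart[OF _ _ _ even(1)] line_apart[OF _ _ _ even(2)] line_apart[OF _ _ _ even(3)]
        line_apart[OF _ _ _ even(4)] line_apart[OF _ _ _ even(5)] line_apart[OF _ _ _ even(6)] that
      by cases auto
  qed
  have claw: False
    if "i \<in> W" "j \<in> W" "k \<in> W" "l \<in> W" "distinct [j, k, l]" "?F i j" "?F i k" "?F i l" for i j k l
    by (rule no_apart_claw[OF p r[OF that(1)] r[OF that(2)] r[OF that(3)] r[OF that(4)] that(6-8)])
      (use that far in auto)
  \<comment> \<open>The case that \<open>y\<close> and \<open>t\<close> are the lowest points of the two lines.\<close>
  have core: False
    if W: "s \<in> W" "x \<in> W" "y \<in> W" "z \<in> W" "t \<in> W"
      and lines: "parity y = xor3 (parity x) (parity s)" "parity t = xor3 (parity z) (parity s)"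
      and dist: "distinct [s, x, y, z, t]"
      and F: "?F s y" "?F x y" "?F s t" "?F z t" for s x y z t
  proof -
    have close: "p (\<phi> i + \<phi> j) \<le> r" if "i \<in> W" "j \<in> W" "i \<noteq> j" "\<not> ?F i j" for i j
      using that far[of i j] by (auto simp: apart_def)
    have "\<not> ?F y z" using claw[of y s x z] W dist F sym by auto
    then have yz: "p (\<phi> y + \<phi> z) \<le> r" using close W dist by auto
    have "\<not> ?F x t" using claw[of t s z x] W dist F sym by auto
    then have xt: "p (\<phi> x + \<phi> t) \<le> r" using close W dist by auto
    have "y + z - (x + t) = 0"
    proof (rule ccontr)
      assume nz: "y + z - (x + t) \<noteq> 0"
      have "parity (y + z - (x + t)) = zero3"
        using lines by (auto simp: parity_add parity_diff xor3_def prod_eq_iff)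
      moreover have "\<bar>fst (y + z - (x + t))\<bar> \<le> 2 * K"
        using height[OF W(2)] height[OF W(3)] height[OF W(4)] height[OF W(5)]
        unfolding fst_diff fst_add abs_le_iff by (intro conjI; linarith)
      ultimately have "2 * R \<le> p ((\<phi> y + \<phi> z) - (\<phi> x + \<phi> t))"
        using half[OF _ nz] by (simp add: diff add)
      then show False
        using is_normD(7)[OF p, of "\<phi> y + \<phi> z" "\<phi> x + \<phi> t"] yz xt rR by linarith
    qed
    then have "y + z = x + t" by simp
    then have "\<phi> y + \<phi> z = \<phi> x + \<phi> t" by (metis add)
    then have z: "\<phi> y - \<phi> x - \<phi> t = - \<phi> z" by (simp add: algebra_simps)
    have "p (\<phi> y - \<phi> x) \<le> r"
      \<comment> \<open>The neighbours of \<open>e = y - x\<close> are \<open>e - y = -x\<close> and, by the equation just found, \<open>e - t = -z\<close>.\<close>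
    proof (rule parallelogram_diagonal_short[OF p, of "\<phi> s" r "\<phi> y" "\<phi> t"])
      show "p (\<phi> y - \<phi> x - \<phi> t) \<le> r" using r W by (simp only: z is_normD(4)[OF p])
      show "p (\<phi> y - \<phi> x - \<phi> y) \<le> r" using r W by (simp add: is_normD(4)[OF p])
    qed (use r W F far dist in auto)
    then show False using far[of y x] W dist by auto
  qed
  have swapped: "parity x = xor3 (parity y) (parity s)" "parity z = xor3 (parity t) (parity s)"
    using lines by (simp_all add: xor3_cancel)
  have "?F s x \<and> ?F s y \<or> ?F x s \<and> ?F x y \<or> ?F y s \<and> ?F y x"
    using min_apart[of s x y] W lines dist by auto
  moreover have "?F s z \<and> ?F s t \<or> ?F z s \<and> ?F z t \<or> ?F t s \<and> ?F t z"
    using min_apart[of s z t] W lines dist by auto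
  moreover have "\<not> (?F s x \<and> ?F s y \<and> ?F s z)" "\<not> (?F s x \<and> ?F s y \<and> ?F s t)"
    "\<not> (?F s z \<and> ?F s t \<and> ?F s x)" "\<not> (?F s z \<and> ?F s t \<and> ?F s y)"
    using claw[of s x y z] claw[of s x y t] claw[of s z t x] claw[of s z t y] W dist by auto
  moreover have "\<not> (?F s y \<and> ?F x y \<and> ?F s t \<and> ?F z t)"
    using core[OF W lines dist] by blast
  moreover have "\<not> (?F s y \<and> ?F x y \<and> ?F s z \<and> ?F t z)"
    using core[OF W(1,2,3,5,4) lines(1) swapped(2)] dist by auto
  moreover have "\<not> (?F s x \<and> ?F y x \<and> ?F s t \<and> ?F z t)"
    using core[OF W(1,3,2,4,5) swapped(1) lines(2)] dist by auto
  moreover have "\<not> (?F s x \<and> ?F y x \<and> ?F s z \<and> ?F t z)"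
    using core[OF W(1,3,2,5,4) swapped] dist by auto
  ultimately show False using sym by blast
qed

section \<open>From nearest-neighbour distances to short vectors\<close>

definition displacement :: "'a::real_vector \<Rightarrow> 'a \<Rightarrow> 'a \<Rightarrow> int3 \<Rightarrow> 'a" where
  "displacement \<alpha> b c u =
     of_int (fst u) *\<^sub>R \<alpha> - (of_int (fst (snd u)) *\<^sub>R b + of_int (snd (snd u)) *\<^sub>R c)"

lemma displacement_add: "displacement \<alpha> b c (u + v) = displacement \<alpha> b c u + displacement \<alpha> b c v"
  by (simp add: displacement_def algebra_simps)

lemma displacement_minus: "displacement \<alpha> b c (- u) = - displacement \<alpha> b c u"
  by (simp add: displacement_def)

lemma planar_lattice_basis:
  fixes L :: "(real ^ 2) set"
  assumes "full_rank_lattice L"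
  obtains b c where "b \<noteq> c" "independent {b, c}"
    "L = range (\<lambda>(i, j). of_int i *\<^sub>R b + of_int j *\<^sub>R c)"
proof -
  obtain B where B: "independent B" "span B = UNIV"
    and L: "L = range (\<lambda>k :: real ^ 2 \<Rightarrow> int. \<Sum>b\<in>B. of_int (k b) *\<^sub>R b)"
    using assms unfolding full_rank_lattice_def by blast
  have "card B = 2"
    using basis_card_eq_dim[of B UNIV] B by (simp add: dim_UNIV)
  then obtain b c where bc: "B = {b, c}" "b \<noteq> c" by (meson card_2_iff)
  have "L = range (\<lambda>(i, j). of_int i *\<^sub>R b + of_int j *\<^sub>R c)"
  proof
    show "L \<subseteq> range (\<lambda>(i, j). of_int i *\<^sub>R b + of_int j *\<^sub>R c)"
      unfolding L using bc by (auto intro!: image_eqI[where x = "(k b, k c)" for k])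
    show "range (\<lambda>(i, j). of_int i *\<^sub>R b + of_int j *\<^sub>R c) \<subseteq> L"
    proof
      fix v assume "v \<in> range (\<lambda>(i, j). of_int i *\<^sub>R b + of_int j *\<^sub>R c)"
      then obtain i j where v: "v = of_int i *\<^sub>R b + of_int j *\<^sub>R c" by auto
      show "v \<in> L" unfolding L
        by (rule image_eqI[where x = "\<lambda>w. if w = b then i else j"]) (use bc v in auto)
    qed
  qed
  then show thesis using that bc B(1) by blast
qed

text \<open>
  The index set \<open>1 \<le> m \<le> N\<close> gives the heights from \<open>n - N\<close> to \<open>n - 1\<close>. Together with its negative this
  asymmetric window fills the symmetric one, and negation preserves the norm.
\<close>

lemma nn_dist_is_least_short_displacement:
  fixes \<alpha> b c :: "real ^ 2"
  assumes p: "is_norm p" and L: "full_rank_lattice L"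
    and Lbc: "L = range (\<lambda>(i, j). of_int i *\<^sub>R b + of_int j *\<^sub>R c)"
    and n: "n \<in> {1..N}"
  defines "M \<equiv> max (int n - 1) (int N - int n)"
  shows "\<exists>u. \<bar>fst u\<bar> \<le> M \<and> displacement \<alpha> b c u \<noteq> 0 \<and> p (displacement \<alpha> b c u) = nn_dist p \<alpha> L N n"
    and "\<And>u. \<bar>fst u\<bar> \<le> M \<Longrightarrow> displacement \<alpha> b c u \<noteq> 0 \<Longrightarrow>
           nn_dist p \<alpha> L N n \<le> p (displacement \<alpha> b c u)"
proof -
  note least = nn_dist_is_minimum[OF p L n, where \<alpha> = \<alpha>]
  obtain m l where ml: "m \<in> {1..N}" "l \<in> L" "real n *\<^sub>R \<alpha> - real m *\<^sub>R \<alpha> - l \<noteq> 0"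
    and d: "nn_dist p \<alpha> L N n = p (real n *\<^sub>R \<alpha> - real m *\<^sub>R \<alpha> - l)"
    using least(1) unfolding nn_dists_def by blast
  obtain i j where l: "l = of_int i *\<^sub>R b + of_int j *\<^sub>R c" using ml(2) Lbc by auto
  have "displacement \<alpha> b c (int n - int m, i, j) = real n *\<^sub>R \<alpha> - real m *\<^sub>R \<alpha> - l"
    by (simp add: displacement_def l algebra_simps)
  moreover have "\<bar>int n - int m\<bar> \<le> M" using ml(1) by (auto simp: M_def)
  ultimately show "\<exists>u. \<bar>fst u\<bar> \<le> M \<and> displacement \<alpha> b c u \<noteq> 0
      \<and> p (displacement \<alpha> b c u) = nn_dist p \<alpha> L N n"
    using ml(3) d by (intro exI[of _ "(int n - int m, i, j)"]) simp
  have window: "nn_dist p \<alpha> L N n \<le> p (displacement \<alpha> b c u)"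
    if "int n - int N \<le> fst u" "fst u \<le> int n - 1" "displacement \<alpha> b c u \<noteq> 0" for u
  proof (rule least(2))
    define m where "m = nat (int n - fst u)"
    have m: "int m = int n - fst u" "m \<in> {1..N}" using that by (auto simp: m_def)
    have "of_int (fst u) = real n - real m" using m(1) by linarith
    then have eq: "displacement \<alpha> b c u = real n *\<^sub>R \<alpha> - real m *\<^sub>R \<alpha>
        - (of_int (fst (snd u)) *\<^sub>R b + of_int (snd (snd u)) *\<^sub>R c)"
      by (simp add: displacement_def scaleR_diff_left)
    have "of_int (fst (snd u)) *\<^sub>R b + of_int (snd (snd u)) *\<^sub>R c \<in> L"
      unfolding Lbc by (rule image_eqI[of _ _ "snd u"]) (auto simp: case_prod_beta)
    then show "p (displacement \<alpha> b c u) \<in> nn_dists p \<alpha> L N n"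
      unfolding nn_dists_def using m(2) that(3) eq
      by (intro CollectI exI[of _ m] exI[of _ "of_int (fst (snd u)) *\<^sub>R b + of_int (snd (snd u)) *\<^sub>R c"])
        simp
  qed
  show "nn_dist p \<alpha> L N n \<le> p (displacement \<alpha> b c u)"
    if u: "\<bar>fst u\<bar> \<le> M" "displacement \<alpha> b c u \<noteq> 0" for u
  proof -
    have "int n - int N \<le> fst u \<and> fst u \<le> int n - 1
        \<or> int n - int N \<le> fst (- u) \<and> fst (- u) \<le> int n - 1"
      using u(1) n by (auto simp: M_def)
    then show ?thesis
      using window[of u] window[of "- u"] u(2) is_normD(4)[OF p] by (auto simp: displacement_minus)
  qed
qed

text \<open>
  At height zero this is independence of the lattice basis. A triple \<open>u\<close> of other height with zero
  displacement would be a period: subtracting multiples of \<open>u\<close> from \<open>w\<close> would bring its height below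
  \<open>K\<close> without changing its displacement, contrary to the bound for such heights.
\<close>

lemma displacement_nonzero_if_short_vector:
  fixes p :: "'a::real_vector \<Rightarrow> real"
  assumes indep: "b \<noteq> c" "independent {b, c}"
    and bound: "\<And>v. \<bar>fst v\<bar> \<le> K \<Longrightarrow> displacement \<alpha> b c v \<noteq> 0 \<Longrightarrow> R \<le> p (displacement \<alpha> b c v)"
    and w: "displacement \<alpha> b c w \<noteq> 0" "p (displacement \<alpha> b c w) < R"
    and u: "u \<noteq> 0" "\<bar>fst u\<bar> \<le> K"
  shows "displacement \<alpha> b c u \<noteq> 0"
proof
  assume 0: "displacement \<alpha> b c u = 0"
  show False
  proof (cases "fst u = 0")
    case True
    then have "of_int (fst (snd u)) *\<^sub>R b + of_int (snd (snd u)) *\<^sub>R c = 0"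
      using 0 unfolding displacement_def True
      by (simp only: of_int_0 scaleR_zero_left diff_0 neg_equal_0_iff_equal)
    then have "(\<Sum>v\<in>{b, c}. (if v = b then of_int (fst (snd u)) else of_int (snd (snd u))) *\<^sub>R v) = 0"
      using indep(1) by simp
    then have "(if v = b then of_int (fst (snd u)) else of_int (snd (snd u)) :: real) = 0"
      if "v \<in> {b, c}" for v
      using independentD[where u = "\<lambda>v. if v = b then of_int (fst (snd u)) else of_int (snd (snd u))",
          OF indep(2) _ subset_refl _ that] by blast
    from this[of b] this[of c] have "u = 0" using True indep(1) by (simp add: prod_eq_iff)
    then show False using u(1) by simp
  next
    case False
    define q where "q = fst w div fst u"
    define v where "v = (fst w - q * fst u, fst (snd w) - q * fst (snd u), snd (snd w) - q * snd (snd u))"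
    have "displacement \<alpha> b c v = displacement \<alpha> b c w - of_int q *\<^sub>R displacement \<alpha> b c u"
      by (simp add: displacement_def v_def algebra_simps)
    then have eq: "displacement \<alpha> b c v = displacement \<alpha> b c w" using 0 by simp
    have "fst v = fst w mod fst u" by (simp add: v_def q_def minus_div_mult_eq_mod)
    then have "\<bar>fst v\<bar> \<le> K" using abs_mod_less[OF False, of "fst w"] u(2) by linarith
    then show False using bound[of v] eq w by simp
  qed
qed

theorem theorem1:
  fixes L :: "(real ^ 2) set" and \<alpha> :: "real ^ 2" and N :: nat
    and p :: "real ^ 2 \<Rightarrow> real"
  assumes "full_rank_lattice L"
    and "N \<ge> 1"
    and "is_norm p"
  shows "num_nn_dists p \<alpha> L N \<le> 5"
proof (rule ccontr)
  assume many: "\<not> num_nn_dists p \<alpha> L N \<le> 5"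
  note L = assms(1) and p = assms(3)
  obtain b c where bc: "b \<noteq> c" "independent {b, c}"
    and Lbc: "L = range (\<lambda>(i, j). of_int i *\<^sub>R b + of_int j *\<^sub>R c)"
    using planar_lattice_basis[OF L] .
  define \<phi> where "\<phi> = displacement \<alpha> b c"
  define M where "M n = max (int n - 1) (int N - int n)" for n
  define K where "K = int (N div 2)"
  define D where "D = nn_dist p \<alpha> L N ` {1..N}"
  define R where "R = Max D"
  note least = nn_dist_is_least_short_displacement[OF p L Lbc, where N = N and \<alpha> = \<alpha>, folded \<phi>_def M_def]
  have M: "K \<le> M n" "M n \<le> 2 * K" if "n \<in> {1..N}" for n
    using that by (auto simp: M_def K_def)
  have card: "finite D" "6 \<le> card D"
    using many by (auto simp: D_def num_nn_dists_def)
  then have "D \<noteq> {}" by auto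
  then have RD: "R \<in> D" using card(1) by (auto simp: R_def)
  have R: "d \<le> R" if "d \<in> D" for d using card(1) that by (auto simp: R_def)
  have bound: "R \<le> p (\<phi> u)" if "\<bar>fst u\<bar> \<le> K" "\<phi> u \<noteq> 0" for u
  proof -
    obtain n where n: "n \<in> {1..N}" "R = nn_dist p \<alpha> L N n" using RD by (auto simp: D_def)
    show ?thesis using least(2)[OF n(1), of u] M(1)[OF n(1)] that n(2) by simp
  qed
  \<comment> \<open>The last clause makes different distances live at different heights.\<close>
  define good where "good d u \<longleftrightarrow> K < fst u \<and> fst u \<le> 2 * K \<and> \<phi> u \<noteq> 0 \<and> p (\<phi> u) = d
      \<and> (\<forall>v. \<bar>fst v\<bar> \<le> fst u \<longrightarrow> \<phi> v \<noteq> 0 \<longrightarrow> d \<le> p (\<phi> v))" for d u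
  have "\<exists>u. good d u" if d: "d \<in> D - {R}" for d
  proof -
    obtain n where n: "n \<in> {1..N}" "d = nn_dist p \<alpha> L N n" using d by (auto simp: D_def)
    obtain u where u: "\<bar>fst u\<bar> \<le> M n" "\<phi> u \<noteq> 0" "p (\<phi> u) = d"
      using least(1)[OF n(1)] n(2) by blast
    have "d < R" using d R by force
    then have "K < \<bar>fst u\<bar>" using bound[of u] u by force
    moreover have "d \<le> p (\<phi> v)" if "\<bar>fst v\<bar> \<le> \<bar>fst u\<bar>" "\<phi> v \<noteq> 0" for v
      using least(2)[OF n(1), of v] that u(1) n(2) by simp
    moreover have "p (\<phi> (- u)) = d" "\<phi> (- u) \<noteq> 0"
      using u is_normD(4)[OF p] by (simp_all add: \<phi>_def displacement_minus)
    ultimately have "good d (if 0 \<le> fst u then u else - u)"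
      using u M(2)[OF n(1)] by (auto simp: good_def)
    then show ?thesis ..
  qed
  then obtain w where w: "good d (w d)" if "d \<in> D - {R}" for d by metis
  have "5 \<le> card (D - {R})" using card RD by simp
  then obtain E where E: "E \<subseteq> D - {R}" "card E = 5" by (meson obtain_subset_with_card_n)
  have goodE: "good d (w d)" "d < R" if "d \<in> E" for d using that E(1) w R by force+
  have "inj_on (\<lambda>d. fst (w d)) E"
  proof
    fix d e assume de: "d \<in> E" "e \<in> E" "fst (w d) = fst (w e)"
    note good = goodE(1)[OF de(1), unfolded good_def] goodE(1)[OF de(2), unfolded good_def]
    have "K \<ge> 0" by (simp add: K_def)
    then have "\<bar>fst (w e)\<bar> \<le> fst (w d)" "\<bar>fst (w d)\<bar> \<le> fst (w e)" using good de(3) by auto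
    then have "e \<le> d" "d \<le> e" using good by metis+
    then show "d = e" by simp
  qed
  then have inj: "inj_on w E" "inj_on fst (w ` E)"
    using inj_on_imageI2[of fst w E] inj_on_imageI[of fst w E] by (auto simp: comp_def)
  have "card (w ` E) \<noteq> 5"
  proof (rule no_five_short_vectors[OF p, of \<phi> K R])
    show "\<phi> (u + v) = \<phi> u + \<phi> v" for u v by (simp add: \<phi>_def displacement_add)
    show "K < fst u \<and> fst u \<le> 2 * K" "p (\<phi> u) < R" if "u \<in> w ` E" for u
      using that goodE by (auto simp: good_def)
    obtain d where d: "d \<in> E" using E(2) by fastforce
    show "R \<le> p (\<phi> u)" if "u \<noteq> 0" "\<bar>fst u\<bar> \<le> K" for u
    proof (rule bound[OF that(2)])
      show "\<phi> u \<noteq> 0"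
        unfolding \<phi>_def
        by (rule displacement_nonzero_if_short_vector[where p = p and w = "w d", OF bc _ _ _ that])
          (use bound goodE[OF d] in \<open>auto simp: \<phi>_def good_def\<close>)
    qed
  qed (rule inj(2))
  then show False using card_image[OF inj(1)] E(2) by simp
qed

end
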